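(* Let $\mathsf r^4_2(q)=\sum q^{\mathrm{rk}(\boldsymbol\sigma)}$, summed over all $\boldsymbol\sigma\in\mathbb Z^4$ with $\sigma_1+\sigma_2+\sigma_3+\sigma_4=2$. Then $$\mathsf r^4_2(q^2)=q\left(\frac{\phi(q)^3-\phi(-q)^3}{2}\right).$$
   Context: For $\boldsymbol\sigma=(\sigma_1,\dots,\sigma_\ell)\in\mathbb Z^\ell$, the rank is $\mathrm{rk}(\boldsymbol\sigma)=\left\lceil\frac{Y-\ell+1}{2\ell}\right\rceil$ where $Y=\sum_{i=1}^{\ell}\sum_{j\ne i}\sigma_i(\sigma_i-\sigma_j)$ (here $\ell=4$). $\phi(q)=\sum_{n\in\mathbb Z}q^{n^2}$. *)

theory Defs
  imports "HOL-Analysis.Analysis"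
begin

definition Y_of :: "int ^ 'n \<Rightarrow> int" where
  "Y_of \<sigma> = (\<Sum>i\<in>UNIV. \<Sum>j\<in>UNIV - {i}. \<sigma> $ i * (\<sigma> $ i - \<sigma> $ j))"

definition rk :: "int ^ 'n \<Rightarrow> int" where
  "rk (\<sigma> :: int ^ 'n) =
     \<lceil>(of_int (Y_of \<sigma>) - of_nat CARD('n) + 1) / (2 * of_nat CARD('n)) :: rat\<rceil>"

text \<open>
  The \<open>q\<close>-series are formal power series with rational coefficients (\<open>fps_X\<close> is \<open>q\<close>), and the
  infinite sums are unordered sums in the standard topology of formal power series.
  Since \<^const>\<open>infsum\<close> is \<open>0\<close> for a non-summable family, summability is proved below,
  as is \<open>rk \<sigma> \<ge> 0\<close>, so that \<^const>\<open>nat\<close> loses nothing in the exponents.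
\<close>

definition phi :: "rat fps" where
  "phi = (\<Sum>\<^sub>\<infinity>n\<in>(UNIV :: int set). fps_X ^ nat (n ^ 2))"

definition r42 :: "rat fps" where
  "r42 = (\<Sum>\<^sub>\<infinity>\<sigma>\<in>{\<sigma> :: int ^ 4. (\<Sum>i\<in>UNIV. \<sigma> $ i) = 2}. fps_X ^ nat (rk \<sigma>))"

lemma has_sum_fps_X_power:
  fixes f :: "'b \<Rightarrow> nat"
  assumes fin: "\<And>k. finite {x \<in> A. f x = k}"
  shows "((\<lambda>x. fps_X ^ f x :: rat fps) has_sum
            Abs_fps (\<lambda>k. of_nat (card {x \<in> A. f x = k}))) A"
  unfolding has_sum_def
proof (rule tendsto_fpsI)
  fix k
  have "eventually (\<lambda>F. finite F \<and> {x \<in> A. f x = k} \<subseteq> F \<and> F \<subseteq> A) (finite_subsets_at_top A)"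
    unfolding eventually_finite_subsets_at_top
    using fin[of k] by (intro exI[of _ "{x \<in> A. f x = k}"]) auto
  then show "eventually (\<lambda>F. fps_nth (sum (\<lambda>x. fps_X ^ f x) F) k =
      fps_nth (Abs_fps (\<lambda>k. of_nat (card {x \<in> A. f x = k})) :: rat fps) k)
      (finite_subsets_at_top A)"
  proof eventually_elim
    case (elim F)
    then have "{x \<in> F. f x = k} = {x \<in> A. f x = k}" by auto
    moreover have "fps_nth (sum (\<lambda>x. fps_X ^ f x :: rat fps) F) k = (\<Sum>x\<in>F. if f x = k then 1 else 0)"
      by (auto simp: fps_sum_nth fps_X_power_nth intro!: sum.cong)
    moreover have "\<dots> = of_nat (card {x \<in> F. f x = k})"
      using elim by (simp add: sum.If_cases Int_def)
    ultimately show ?case by simp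
  qed
qed

lemma Y_of_nonneg: "Y_of (\<sigma> :: int ^ 'n) \<ge> 0"
proof -
  let ?f = "\<lambda>i j. \<sigma> $ i * (\<sigma> $ i - \<sigma> $ j)"
  have Y: "Y_of \<sigma> = (\<Sum>i\<in>UNIV. \<Sum>j\<in>UNIV. ?f i j)"
    unfolding Y_of_def by (intro sum.cong refl sum.mono_neutral_left) auto
  also have "\<dots> = (\<Sum>i\<in>UNIV. \<Sum>j\<in>UNIV. ?f j i)"
    by (rule sum.swap)
  finally have "2 * Y_of \<sigma> = (\<Sum>i\<in>UNIV. \<Sum>j\<in>UNIV. ?f i j + ?f j i)"
    using Y by (simp add: sum.distrib)
  also have "\<dots> = (\<Sum>i\<in>UNIV. \<Sum>j\<in>UNIV. (\<sigma> $ i - \<sigma> $ j)\<^sup>2)"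
    by (intro sum.cong refl) (simp add: power2_eq_square algebra_simps)
  also have "\<dots> \<ge> 0"
    by (intro sum_nonneg) simp
  finally show ?thesis by simp
qed

lemma rk_nonneg: "rk (\<sigma> :: int ^ 'n) \<ge> 0"
proof -
  define c where "c = (of_nat CARD('n) :: rat)"
  define y where "y = (of_int (Y_of \<sigma>) :: rat)"
  have "c > 0" by (simp add: c_def)
  have "y \<ge> 0" using Y_of_nonneg by (simp add: y_def)
  have "(y - c + 1) / (2 * c) > -1"
    using \<open>c > 0\<close> \<open>y \<ge> 0\<close> by (simp add: field_simps)
  then show ?thesis
    by (simp add: rk_def c_def y_def zero_le_ceiling)
qed

lemma finite_int_bounded_square: "finite {n :: int. n ^ 2 \<le> B}"
proof (rule finite_subset)
  show "{n :: int. n ^ 2 \<le> B} \<subseteq> {-B..B}"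
  proof
    fix n :: int assume "n \<in> {n. n ^ 2 \<le> B}"
    moreover have "\<bar>n\<bar> \<le> n ^ 2"
      using self_le_power[of "\<bar>n\<bar>" 2] by (cases "n = 0") auto
    ultimately show "n \<in> {-B..B}" by auto
  qed
qed simp

lemma phi_summable: "(\<lambda>n. fps_X ^ nat (n ^ 2) :: rat fps) summable_on (UNIV :: int set)"
proof -
  have "finite {n \<in> UNIV :: int set. nat (n ^ 2) = k}" for k
    by (rule finite_subset[OF _ finite_int_bounded_square[of "int k"]]) auto
  from has_sum_fps_X_power[OF this] show ?thesis
    by (auto simp: summable_on_def)
qed

lemma Y_of_conv:
  fixes \<sigma> :: "int ^ 'n"
  shows "Y_of \<sigma> = int CARD('n) * (\<Sum>i\<in>UNIV. (\<sigma> $ i) ^ 2) - (\<Sum>i\<in>UNIV. \<sigma> $ i) ^ 2"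
proof -
  have "Y_of \<sigma> = (\<Sum>i\<in>UNIV. \<Sum>j\<in>UNIV. \<sigma> $ i * (\<sigma> $ i - \<sigma> $ j))"
    unfolding Y_of_def by (intro sum.cong refl sum.mono_neutral_left) auto
  also have "\<dots> = (\<Sum>i\<in>UNIV. int CARD('n) * (\<sigma> $ i) ^ 2 - \<sigma> $ i * (\<Sum>j\<in>UNIV. \<sigma> $ j))"
    by (intro sum.cong refl)
       (simp add: right_diff_distrib sum_subtractf power2_eq_square sum_distrib_left)
  finally show ?thesis
    by (simp add: sum_subtractf power2_eq_square flip: sum_distrib_left sum_distrib_right)
qed

lemma r42_summable:
  "(\<lambda>\<sigma>. fps_X ^ nat (rk \<sigma>) :: rat fps) summable_on {\<sigma> :: int ^ 4. (\<Sum>i\<in>UNIV. \<sigma> $ i) = 2}"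
proof -
  have "finite {\<sigma> \<in> {\<sigma> :: int ^ 4. (\<Sum>i\<in>UNIV. \<sigma> $ i) = 2}. nat (rk \<sigma>) = k}" for k
  proof (rule finite_subset)
    let ?S = "{n :: int. n ^ 2 \<le> 8 * int k + 7}"
    have "finite (vec_lambda ` PiE (UNIV :: 4 set) (\<lambda>_. ?S))"
      using finite_int_bounded_square by (intro finite_imageI finite_PiE) auto
    moreover have "{\<sigma> :: int ^ 4. \<forall>i. \<sigma> $ i \<in> ?S} \<subseteq> vec_lambda ` PiE UNIV (\<lambda>_. ?S)"
    proof
      fix \<sigma> :: "int ^ 4" assume "\<sigma> \<in> {\<sigma>. \<forall>i. \<sigma> $ i \<in> ?S}"
      then show "\<sigma> \<in> vec_lambda ` PiE UNIV (\<lambda>_. ?S)"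
        by (intro image_eqI[of _ _ "vec_nth \<sigma>"]) (auto simp: vec_lambda_eta)
    qed
    ultimately show "finite {\<sigma> :: int ^ 4. \<forall>i. \<sigma> $ i \<in> ?S}"
      by (rule rev_finite_subset)
    show "{\<sigma> \<in> {\<sigma> :: int ^ 4. (\<Sum>i\<in>UNIV. \<sigma> $ i) = 2}. nat (rk \<sigma>) = k}
        \<subseteq> {\<sigma>. \<forall>i. \<sigma> $ i \<in> ?S}"
    proof clarify
      fix \<sigma> :: "int ^ 4" and i
      assume s: "(\<Sum>i\<in>UNIV. \<sigma> $ i) = 2" and k: "k = nat (rk \<sigma>)"
      have "(of_int (Y_of \<sigma>) - 3) / 8 \<le> (of_int (rk \<sigma>) :: rat)"
        using le_of_int_ceiling[of "(of_int (Y_of \<sigma>) - 3) / 8 :: rat"] by (simp add: rk_def)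
      then have "of_int (Y_of \<sigma>) \<le> (of_int (8 * rk \<sigma> + 3) :: rat)"
        by simp
      then have "Y_of \<sigma> \<le> 8 * rk \<sigma> + 3"
        by (simp only: of_int_le_iff)
      then have "4 * (\<Sum>i\<in>UNIV. (\<sigma> $ i) ^ 2) \<le> 8 * int k + 7"
        using s k rk_nonneg[of \<sigma>] by (simp add: Y_of_conv)
      moreover have "(\<sigma> $ i) ^ 2 \<le> (\<Sum>i\<in>UNIV. (\<sigma> $ i) ^ 2)"
        by (rule member_le_sum) auto
      moreover have "0 \<le> (\<sigma> $ i) ^ 2" by simp
      ultimately show "(\<sigma> $ i) ^ 2 \<le> 8 * int (nat (rk \<sigma>)) + 7"
        using k by linarith
    qed
  qed
  from has_sum_fps_X_power[OF this] show ?thesis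
    by (auto simp: summable_on_def)
qed

end

theory Submission
  imports Defs "HOL-Computational_Algebra.Formal_Laurent_Series"
begin

text \<open>
  Write \<open>N = \<sigma>\<^sub>1\<^sup>2 + \<sigma>\<^sub>2\<^sup>2 + \<sigma>\<^sub>3\<^sup>2 + \<sigma>\<^sub>4\<^sup>2\<close>.  When the entries of \<open>\<sigma>\<close> sum to \<open>2\<close>, we have
  \<open>Y = 4 N - 4\<close>, and \<open>N\<close> is even, so that the rank \<open>\<lceil>(4 N - 7) / 8\<rceil>\<close> is just \<open>N / 2\<close>.  Hence the
  left-hand side counts the vectors \<open>\<sigma>\<close> of coordinate sum \<open>2\<close> by their squared length \<open>N\<close>.

  The orthogonal matrix with rows \<open>(1, 1, 1, 1) / 2\<close>, \<open>(1, 1, -1, -1) / 2\<close>,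
  \<open>(1, -1, 1, -1) / 2\<close> and \<open>(1, -1, -1, 1) / 2\<close> sends such a \<open>\<sigma>\<close> to a vector \<open>(1, x, y, z)\<close> of
  the same length, where \<open>x = \<sigma>\<^sub>1 + \<sigma>\<^sub>2 - 1\<close>, \<open>y = \<sigma>\<^sub>1 + \<sigma>\<^sub>3 - 1\<close> and \<open>z = \<sigma>\<^sub>1 + \<sigma>\<^sub>4 - 1\<close> are integers
  with \<open>x + y + z = 2 \<sigma>\<^sub>1 - 1\<close> odd.  Every integer triple with odd sum arises from exactly one
  \<open>\<sigma>\<close> (\<open>bij_betw_sum_two_odd_triples\<close>).  So the left-hand side is \<open>q\<close> times the sum of
  \<open>q\<^bsup>x\<^sup>2 + y\<^sup>2 + z\<^sup>2\<^esup>\<close> over the triples for which \<open>x\<^sup>2 + y\<^sup>2 + z\<^sup>2\<close>, which has the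
  parity of \<open>x + y + z\<close>, is odd.  Without the parity
  condition that sum is \<open>\<phi>(q)\<^sup>3\<close>, and \<open>(F(q) - F(-q)) / 2\<close> extracts the odd part of a series \<open>F\<close>.
\<close>

section \<open>Counting series\<close>

text \<open>
  The sum of \<open>q\<^bsup>f x\<^esup>\<close> over \<open>x \<in> A\<close>, given by its coefficients: for finite fibres it agrees with
  the unordered infinite sum, and all manipulations become statements about cardinalities.
\<close>

definition counting_series :: "'a set \<Rightarrow> ('a \<Rightarrow> nat) \<Rightarrow> rat fps" where
  "counting_series A f = Abs_fps (\<lambda>k. of_nat (card {x \<in> A. f x = k}))"

lemma infsum_fps_X_power:
  assumes "\<And>k. finite {x \<in> A. f x = k}"
  shows "(\<Sum>\<^sub>\<infinity>x\<in>A. fps_X ^ f x) = counting_series A f"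
  unfolding counting_series_def by (rule infsumI has_sum_fps_X_power assms)+

lemma counting_series_reindex:
  assumes "bij_betw g A B" and "\<And>x. x \<in> A \<Longrightarrow> f x = f' (g x)"
  shows "counting_series A f = counting_series B f'"
proof -
  have "bij_betw g {x \<in> A. f x = k} {y \<in> B. f' y = k}" for k
    using assms by (auto simp: bij_betw_def inj_on_def)
  from bij_betw_same_card[OF this] show ?thesis
    by (simp add: counting_series_def)
qed

lemma prod_fibre_eq_UN:
  fixes f :: "'a \<Rightarrow> nat" and g :: "'b \<Rightarrow> nat"
  shows "{p \<in> A \<times> B. f (fst p) + g (snd p) = k} =
           (\<Union>i\<in>{0..k}. {x \<in> A. f x = i} \<times> {y \<in> B. g y = k - i})"
  by auto

lemma finite_prod_fibre:
  fixes f :: "'a \<Rightarrow> nat" and g :: "'b \<Rightarrow> nat"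
  assumes "\<And>k. finite {x \<in> A. f x = k}" and "\<And>k. finite {y \<in> B. g y = k}"
  shows "finite {p \<in> A \<times> B. f (fst p) + g (snd p) = k}"
  unfolding prod_fibre_eq_UN using assms by auto

lemma counting_series_mult:
  assumes "\<And>k. finite {x \<in> A. f x = k}" and "\<And>k. finite {y \<in> B. g y = k}"
  shows "counting_series A f * counting_series B g =
           counting_series (A \<times> B) (\<lambda>p. f (fst p) + g (snd p))"
proof (rule fps_ext)
  fix k
  have "card {p \<in> A \<times> B. f (fst p) + g (snd p) = k} =
          (\<Sum>i=0..k. card ({x \<in> A. f x = i} \<times> {y \<in> B. g y = k - i}))"
    unfolding prod_fibre_eq_UN using assms by (intro card_UN_disjoint) auto
  then show "fps_nth (counting_series A f * counting_series B g) k =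
      fps_nth (counting_series (A \<times> B) (\<lambda>p. f (fst p) + g (snd p))) k"
    by (simp add: counting_series_def fps_mult_nth card_cartesian_product)
qed

lemma counting_series_compose_X_power:
  assumes "d > 0"
  shows "fps_compose (counting_series A f) (fps_X ^ d) = counting_series A (\<lambda>x. d * f x)"
proof (rule fps_ext)
  fix k
  have "{x \<in> A. d * f x = k} = (if d dvd k then {x \<in> A. f x = k div d} else {})"
    using assms by auto
  then show "fps_nth (fps_compose (counting_series A f) (fps_X ^ d)) k =
      fps_nth (counting_series A (\<lambda>x. d * f x)) k"
    using assms by (simp add: counting_series_def fps_nth_compose_X_power)
qed

lemma fps_X_mult_counting_series:
  "fps_X * counting_series A f = counting_series A (\<lambda>x. Suc (f x))"
proof (rule fps_ext)
  fix k
  show "fps_nth (fps_X * counting_series A f) k = fps_nth (counting_series A (\<lambda>x. Suc (f x))) k"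
    by (cases k) (simp_all add: counting_series_def)
qed

lemma counting_series_odd_part:
  "(counting_series A f - fps_compose (counting_series A f) (- fps_X)) / 2 =
     counting_series {x \<in> A. odd (f x)} f"
proof -
  have "counting_series A f - fps_compose (counting_series A f) (- fps_X) =
          2 * counting_series {x \<in> A. odd (f x)} f"
  proof (rule fps_ext)
    fix k
    have "{x. (x \<in> A \<and> odd (f x)) \<and> f x = k} = (if odd k then {x \<in> A. f x = k} else {})"
      by auto
    then show "fps_nth (counting_series A f - fps_compose (counting_series A f) (- fps_X)) k =
        fps_nth (2 * counting_series {x \<in> A. odd (f x)} f) k"
      by (simp add: counting_series_def fps_compose_uminus' numeral_fps_const)
  qed
  then show ?thesis by simp
qed

section \<open>The cube of the theta series\<close>

lemma phi_eq_counting_series: "phi = counting_series UNIV (\<lambda>n :: int. nat (n ^ 2))"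
  and finite_square_fibre: "finite {n \<in> UNIV :: int set. nat (n ^ 2) = k}"
proof -
  show fin: "finite {n \<in> UNIV :: int set. nat (n ^ 2) = k}" for k
    by (rule finite_subset[OF _ finite_int_bounded_square[of "int k"]]) auto
  show "phi = counting_series UNIV (\<lambda>n :: int. nat (n ^ 2))"
    unfolding phi_def by (rule infsum_fps_X_power[OF fin])
qed

definition triple_norm :: "int \<times> int \<times> int \<Rightarrow> nat" where
  "triple_norm = (\<lambda>(x, y, z). nat (x ^ 2 + y ^ 2 + z ^ 2))"

lemma triple_norm_eq:
  "triple_norm p = nat (fst p ^ 2) + (nat (fst (snd p) ^ 2) + nat (snd (snd p) ^ 2))"
  by (simp add: triple_norm_def case_prod_beta nat_add_distrib)

lemma finite_triple_norm_fibre: "finite {t. triple_norm t = k}"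
  using finite_prod_fibre[OF finite_square_fibre finite_prod_fibre[OF finite_square_fibre finite_square_fibre]]
  by (simp add: triple_norm_eq)

lemma phi_cube_eq_counting_series: "phi ^ 3 = counting_series UNIV triple_norm"
proof -
  have "phi ^ 3 = phi * (phi * phi)"
    by (simp add: power3_eq_cube mult.assoc)
  also have "\<dots> = counting_series UNIV
      (\<lambda>p :: int \<times> int \<times> int. nat (fst p ^ 2) + (nat (fst (snd p) ^ 2) + nat (snd (snd p) ^ 2)))"
    unfolding phi_eq_counting_series
      counting_series_mult[OF finite_square_fibre finite_square_fibre]
      counting_series_mult[OF finite_square_fibre finite_prod_fibre[OF finite_square_fibre finite_square_fibre]]
    by simp
  finally show ?thesis
    by (simp add: triple_norm_eq[abs_def])
qed

section \<open>Vectors of coordinate sum two\<close>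

abbreviation sum_two :: "(int ^ 4) set" where
  "sum_two \<equiv> {\<sigma>. (\<Sum>i\<in>UNIV. \<sigma> $ i) = 2}"

text \<open>
  Since \<open>n\<^sup>2\<close> and \<open>n\<close> have the same parity, the squared length is even.  This makes the ceiling
  in the rank harmless: it rounds \<open>(4 N - 7) / 8\<close> up to the integer \<open>N / 2\<close>.
\<close>

lemma two_rk_eq_sum_squares:
  assumes "\<sigma> \<in> sum_two"
  shows "2 * rk \<sigma> = (\<Sum>i\<in>UNIV. (\<sigma> $ i) ^ 2)"
proof -
  define N where "N = (\<Sum>i\<in>UNIV. (\<sigma> $ i) ^ 2)"
  have "even N \<longleftrightarrow> even (\<Sum>i\<in>UNIV. \<sigma> $ i)"
    unfolding N_def sum_4 by simp
  then obtain m where m: "N = 2 * m"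
    using assms by (auto elim: evenE)
  have "Y_of \<sigma> = 8 * m - 4"
    using assms m by (simp add: Y_of_conv flip: N_def)
  then have "rk \<sigma> = \<lceil>(of_int (8 * m - 4) - 3) / 8 :: rat\<rceil>"
    by (simp only: rk_def) simp
  also have "\<dots> = m"
    by (rule ceiling_unique) (simp_all add: field_simps)
  finally show ?thesis
    using m by (simp add: N_def)
qed

text \<open>
  The last three coordinates of the image of \<open>\<sigma>\<close> under the orthogonal matrix above, with
  \<open>\<sigma>\<^sub>1 + \<sigma>\<^sub>2 + \<sigma>\<^sub>3 + \<sigma>\<^sub>4 = 2\<close> used to clear the denominators.
\<close>

definition hadamard_triple :: "int ^ 4 \<Rightarrow> int \<times> int \<times> int" where
  "hadamard_triple \<sigma> = (\<sigma> $ 1 + \<sigma> $ 2 - 1, \<sigma> $ 1 + \<sigma> $ 3 - 1, \<sigma> $ 1 + \<sigma> $ 4 - 1)"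

text \<open>
  The orthogonal matrix preserves length; the successor accounts for the first coordinate of the
  image, which is half the coordinate sum and hence \<open>1\<close>.
\<close>

lemma triple_norm_hadamard:
  assumes "\<sigma> \<in> sum_two"
  shows "Suc (triple_norm (hadamard_triple \<sigma>)) = nat (\<Sum>i\<in>UNIV. (\<sigma> $ i) ^ 2)"
proof -
  define x y z where "x = \<sigma> $ 1 + \<sigma> $ 2 - 1" and "y = \<sigma> $ 1 + \<sigma> $ 3 - 1" and "z = \<sigma> $ 1 + \<sigma> $ 4 - 1"
  have s: "\<sigma> $ 4 = 2 - \<sigma> $ 1 - \<sigma> $ 2 - \<sigma> $ 3"
    using assms by (simp add: sum_4)
  have "(\<Sum>i\<in>UNIV. (\<sigma> $ i) ^ 2) = 1 + (x ^ 2 + y ^ 2 + z ^ 2)"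
    unfolding sum_4 x_def y_def z_def s by (simp add: power2_eq_square algebra_simps)
  moreover have "0 \<le> x ^ 2 + y ^ 2 + z ^ 2"
    by simp
  ultimately show ?thesis
    by (simp add: triple_norm_def hadamard_triple_def nat_add_distrib flip: x_def y_def z_def)
qed

lemma odd_triple_norm_iff: "odd (triple_norm (x, y, z)) \<longleftrightarrow> odd (x + y + z)"
  by (simp add: triple_norm_def even_nat_iff)

lemma bij_betw_sum_two_odd_triples:
  "bij_betw hadamard_triple sum_two {t. odd (triple_norm t)}"
proof (rule bij_betw_imageI)
  show "inj_on hadamard_triple sum_two"
    by (rule inj_onI) (auto simp: hadamard_triple_def vec_eq_iff forall_4 sum_4)
  show "hadamard_triple ` sum_two = {t. odd (triple_norm t)}"
  proof (intro equalityI subsetI)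
    fix t assume "t \<in> hadamard_triple ` sum_two"
    then obtain \<sigma> :: "int ^ 4" where "\<sigma> $ 1 + \<sigma> $ 2 + \<sigma> $ 3 + \<sigma> $ 4 = 2" and t: "t = hadamard_triple \<sigma>"
      by (auto simp: sum_4)
    then have eq: "(\<sigma> $ 1 + \<sigma> $ 2 - 1) + (\<sigma> $ 1 + \<sigma> $ 3 - 1) + (\<sigma> $ 1 + \<sigma> $ 4 - 1) = 2 * (\<sigma> $ 1 - 1) + 1"
      by simp
    show "t \<in> {t. odd (triple_norm t)}"
      unfolding t hadamard_triple_def mem_Collect_eq odd_triple_norm_iff eq by simp
  next
    fix t assume "t \<in> {t. odd (triple_norm t)}"
    moreover obtain x y z where t: "t = (x, y, z)"
      by (cases t)
    ultimately have "odd (x + y + z)"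
      by (simp only: mem_Collect_eq odd_triple_norm_iff not_False_eq_True)
    then obtain m where m: "x + y + z = 2 * m + 1"
      by (elim oddE)
    \<comment> \<open>Here \<open>x + y + z = 2 \<sigma>\<^sub>1 - 1\<close> forces \<open>\<sigma>\<^sub>1 = m + 1\<close>, and then \<open>x\<close>, \<open>y\<close>, \<open>z\<close> give the other entries.\<close>
    define \<sigma> :: "int ^ 4" where
      "\<sigma> = (\<chi> i. if i = 1 then m + 1 else if i = 2 then x - m else if i = 3 then y - m else z - m)"
    have "\<sigma> $ 1 = m + 1" "\<sigma> $ 2 = x - m" "\<sigma> $ 3 = y - m" "\<sigma> $ 4 = z - m"
      by (simp_all add: \<sigma>_def)
    then have "\<sigma> \<in> sum_two" "hadamard_triple \<sigma> = t"
      using m by (simp_all add: sum_4 hadamard_triple_def t)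
    then show "t \<in> hadamard_triple ` sum_two"
      by blast
  qed
qed

lemma double_nat_rk_eq:
  assumes "\<sigma> \<in> sum_two"
  shows "2 * nat (rk \<sigma>) = Suc (triple_norm (hadamard_triple \<sigma>))"
  using two_rk_eq_sum_squares[OF assms] triple_norm_hadamard[OF assms] by linarith

text \<open>
  Finiteness is inherited from the triples along the injection: a rank \<open>k\<close> fixes the squared length
  of the triple.
\<close>

lemma finite_rk_fibre: "finite {\<sigma> \<in> sum_two. nat (rk \<sigma>) = k}"
proof (rule inj_on_finite)
  show "inj_on hadamard_triple {\<sigma> \<in> sum_two. nat (rk \<sigma>) = k}"
    using bij_betw_imp_inj_on[OF bij_betw_sum_two_odd_triples] by (rule inj_on_subset) auto
  show "hadamard_triple ` {\<sigma> \<in> sum_two. nat (rk \<sigma>) = k} \<subseteq> {t. triple_norm t = 2 * k - 1}"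
  proof (rule image_subsetI)
    fix \<sigma> assume "\<sigma> \<in> {\<sigma> \<in> sum_two. nat (rk \<sigma>) = k}"
    then show "hadamard_triple \<sigma> \<in> {t. triple_norm t = 2 * k - 1}"
      using double_nat_rk_eq[of \<sigma>] by auto
  qed
qed (rule finite_triple_norm_fibre)

theorem lemma4p9:
  shows "fps_compose r42 (fps_X ^ 2) =
           fps_X * ((phi ^ 3 - (fps_compose phi (- fps_X)) ^ 3) / 2)"
proof -
  have "fps_compose r42 (fps_X ^ 2) = counting_series sum_two (\<lambda>\<sigma>. 2 * nat (rk \<sigma>))"
    by (simp add: r42_def infsum_fps_X_power[OF finite_rk_fibre] counting_series_compose_X_power)
  also have "\<dots> = counting_series {t. odd (triple_norm t)} (\<lambda>t. Suc (triple_norm t))"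
    by (rule counting_series_reindex[OF bij_betw_sum_two_odd_triples]) (rule double_nat_rk_eq)
  also have "\<dots> = fps_X * ((phi ^ 3 - fps_compose (phi ^ 3) (- fps_X)) / 2)"
    by (simp add: phi_cube_eq_counting_series counting_series_odd_part fps_X_mult_counting_series)
  also have "fps_compose (phi ^ 3) (- fps_X) = fps_compose phi (- fps_X) ^ 3"
    by (rule fps_compose_power[symmetric]) simp
  finally show ?thesis .
qed

end
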